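(* Let $$A(x,y,z)=\sum_{n\geq 0}\sum_{\mathscr{D}\in\mathcal{P}_n}x^ny^{v(\mathscr{D})}z^{tf(\mathscr{D})}.$$ Then $$A(x,y,z)=\frac{-1+xy+2x^2y-2x^2y^2+xz-2xyz-2x^2yz+2x^2y^2z+\sqrt{1-2xy-4x^2y+x^2y^2-2xz+2x^2yz+x^2z^2}}{2xy(xyz-z-xy)}.$$
   Context: A Dyck path of semilength $n$ is a lattice path from $(0,0)$ consisting of $n$ up steps $U=(1,1)$ and $n$ down steps $D=(1,-1)$, never going below the $x$-axis and ending on the $x$-axis; $\mathcal{P}_n$ is the set of such paths ($\mathcal{P}_0$ contains only the empty path). $v(\mathscr{D})$ is the number of valleys (occurrences of consecutive steps $DU$) and $tf(\mathscr{D})$ the number of triple falls (occurrences of consecutive steps $DDD$) of $\mathscr{D}$. The square root is the formal power series branch with constant term $1$. *)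

theory Defs
  imports "HOL-Computational_Algebra.Computational_Algebra"
begin

datatype step = U | D

fun rise :: "step \<Rightarrow> int" where
  "rise U = 1"
| "rise D = -1"

text \<open>
  A lattice path from the origin is given by its list of steps; the point reached after
  \<open>k\<close> steps has abscissa \<open>k\<close> and ordinate \<open>height (take k w)\<close>.
\<close>

definition height :: "step list \<Rightarrow> int" where
  "height w = sum_list (map rise w)"

definition dyck_paths :: "nat \<Rightarrow> step list set" where
  "dyck_paths n = {w. count_list w U = n \<and> count_list w D = n \<and>
     (\<forall>k\<le>length w. 0 \<le> height (take k w)) \<and> height w = 0}"

text \<open>Occurrences as consecutive steps; they may overlap, so \<open>DDDD\<close> contains \<open>DDD\<close> twice.\<close>

definition occurrences :: "step list \<Rightarrow> step list \<Rightarrow> nat" where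
  "occurrences p w = card {i. i + length p \<le> length w \<and> take (length p) (drop i w) = p}"

definition valleys :: "step list \<Rightarrow> nat" where
  "valleys w = occurrences [D, U] w"

definition triple_falls :: "step list \<Rightarrow> nat" where
  "triple_falls w = occurrences [D, D, D] w"

lemma finite_dyck_paths: "finite (dyck_paths n)"
proof -
  have len: "length w = count_list w U + count_list w D" for w :: "step list"
  proof (induction w)
    case (Cons a w)
    then show ?case by (cases a) auto
  qed simp
  have "finite (UNIV :: step set)"
    by (rule finite_subset[of _ "{U, D}"]) (use step.exhaust in auto)
  then have "finite {w :: step list. set w \<subseteq> UNIV \<and> length w = 2 * n}"
    by (rule finite_lists_length_eq)
  moreover have "dyck_paths n \<subseteq> {w. set w \<subseteq> UNIV \<and> length w = 2 * n}"
    by (auto simp: dyck_paths_def len)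
  ultimately show ?thesis by (rule rev_finite_subset)
qed

text \<open>
  The indeterminates \<open>y\<close> and \<open>z\<close> live in the field of rational functions in two variables
  over the rationals, where the inner polynomial variable is \<open>y\<close> and the outer one is \<open>z\<close>.
\<close>

type_synonym ratfun = "rat poly poly fract"

definition indet_y :: ratfun where
  "indet_y = to_fract [:[:0, 1:]:]"

definition indet_z :: ratfun where
  "indet_z = to_fract [:0, 1:]"

definition dyck_gf :: "ratfun fps" where
  "dyck_gf = Abs_fps (\<lambda>n. \<Sum>w\<in>dyck_paths n. indet_y ^ valleys w * indet_z ^ triple_falls w)"

text \<open>
  The square root of a power series with constant term 1, on the branch with constant term 1:
  the first argument of \<open>fps_radical\<close> prescribes the constant term of the root.
\<close>

definition fps_sqrt1 :: "'a::field_char_0 fps \<Rightarrow> 'a fps" where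
  "fps_sqrt1 f = fps_radical (\<lambda>_ _. 1) 2 f"

lemma fps_sqrt1_iff:
  fixes f g :: "'a::field_char_0 fps"
  assumes "fps_nth f 0 = 1"
  shows "g = fps_sqrt1 f \<longleftrightarrow> g ^ 2 = f \<and> fps_nth g 0 = 1"
proof -
  have "fps_nth (fps_sqrt1 f) 0 = 1"
    by (simp add: fps_sqrt1_def)
  moreover have "g ^ 2 = f \<longleftrightarrow> g = fps_sqrt1 f" if "fps_nth g 0 = 1"
    using radical_unique[of "\<lambda>_ _. 1" 1 f g] that assms
    by (simp add: fps_sqrt1_def numeral_2_eq_2)
  ultimately show ?thesis by auto
qed

end

theory Submission
  imports Defs
begin

text \<open>
  Every nonempty Dyck path is uniquely \<open>U u D v\<close> with Dyck paths \<open>u\<close> and \<open>v\<close>. The closing step \<open>D\<close>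
  creates a triple fall exactly if \<open>u\<close> ends in \<open>DD\<close>, so alongside \<open>A\<close> one considers the generating
  function \<open>C\<close> in which a path ending in \<open>DD\<close> carries an additional factor \<open>z\<close>. The decomposition
  gives \<open>A = 1 + x C (1 + y (A - 1))\<close> and \<open>C = 1 + x (1 + z (C - 1) + y C (C - 1))\<close>. The second
  equation is quadratic in \<open>C\<close>; its discriminant is the radicand of the theorem, with square root
  \<open>1 + x y - x z - 2 x y C\<close>, and eliminating \<open>C\<close> yields the formula for \<open>A\<close>.
\<close>

section \<open>The first return decomposition\<close>

text \<open>Since \<open>take\<close> saturates, \<open>k\<close> may range over all naturals.
  Leaving out the semilength lets a path and its factors be treated alike.\<close>

definition is_dyck :: "step list \<Rightarrow> bool" where
  "is_dyck w \<longleftrightarrow> (\<forall>k. 0 \<le> height (take k w)) \<and> height w = 0"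

lemma height_simps [simp]:
  "height [] = 0" "height (a # w) = rise a + height w" "height (u @ v) = height u + height v"
  by (simp_all add: height_def)

lemma height_eq_count: "height w = int (count_list w U) - int (count_list w D)"
proof (induction w)
  case (Cons a w)
  then show ?case by (cases a) auto
qed simp

lemma dyck_paths_eq: "dyck_paths n = {w. is_dyck w \<and> count_list w U = n}"
proof -
  have "(\<forall>k. 0 \<le> height (take k w)) \<longleftrightarrow> (\<forall>k\<le>length w. 0 \<le> height (take k w))" for w
    by (metis nle_le take_all_iff)
  moreover have "count_list w D = n \<longleftrightarrow> height w = 0" if "count_list w U = n" for w
    using that by (auto simp: height_eq_count)
  ultimately show ?thesis
    unfolding dyck_paths_def is_dyck_def by blast
qed

lemma is_dyck_Nil [simp]: "is_dyck []"
  by (simp add: is_dyck_def)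

lemma is_dyck_hd: "is_dyck w \<Longrightarrow> w \<noteq> [] \<Longrightarrow> \<exists>w'. w = U # w'"
proof (cases w)
  case (Cons a w')
  assume "is_dyck w"
  then have "0 \<le> height (take 1 w)" by (simp add: is_dyck_def)
  with Cons show ?thesis by (cases a) auto
qed simp

lemma is_dyck_last: "is_dyck w \<Longrightarrow> w \<noteq> [] \<Longrightarrow> \<exists>w'. w = w' @ [D]"
proof (cases w rule: rev_cases)
  case (snoc w' a)
  assume "is_dyck w"
  then have "0 \<le> height (take (length w') w)" "height w = 0" by (simp_all add: is_dyck_def)
  with snoc show ?thesis by (cases a) auto
qed simp

lemma is_dyck_join:
  assumes "is_dyck u" "is_dyck v"
  shows "is_dyck (U # u @ D # v)"
  unfolding is_dyck_def
proof (intro conjI allI)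
  fix k
  show "0 \<le> height (take k (U # u @ D # v))"
  proof (cases k)
    case (Suc j)
    have "0 \<le> height (take j u)"
      using assms(1) by (simp add: is_dyck_def)
    \<comment> \<open>The initial \<open>U\<close> compensates for the \<open>D\<close>, which can
      pull this part down to -1 at worst.\<close>
    moreover have "-1 \<le> height (take i (D # v))" for i
      using assms(2) by (cases i) (auto simp: is_dyck_def intro: less_le_trans[of "-1" 0])
    then have "-1 \<le> height (take (j - length u) (D # v))" .
    ultimately show ?thesis by (simp add: Suc)
  qed simp
qed (use assms in \<open>simp add: is_dyck_def\<close>)

lemma is_dyck_split:
  assumes "is_dyck w" "w \<noteq> []"
  obtains u v where "w = U # u @ D # v" "is_dyck u" "is_dyck v"
proof -
  obtain w' where w: "w = U # w'"
    using is_dyck_hd assms by blast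
  have pre: "-1 \<le> height (take k w')" for k
  proof -
    have "0 \<le> height (take (Suc k) w)" using assms unfolding is_dyck_def by blast
    then show ?thesis by (simp add: w)
  qed
  have total: "height w' = -1"
    using assms by (simp add: is_dyck_def w)
  \<comment> \<open>The shortest prefix of \<open>w'\<close> that undoes the initial
    \<open>U\<close> marks the first return of \<open>w\<close> to the axis.\<close>
  define k where "k = (LEAST k. height (take k w') < 0)"
  have k: "height (take k w') < 0"
    unfolding k_def by (rule LeastI[of _ "length w'"]) (simp add: total)
  have least: "0 \<le> height (take j w')" if "j < k" for j
    using not_less_Least[OF that[unfolded k_def]] by simp
  obtain j where j: "k = Suc j"
    using k by (cases k) auto
  have "j < length w'"
  proof (rule ccontr)
    assume "\<not> j < length w'"
    then have "take k w' = take j w'" by (simp add: j)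
    with k least[of j] j show False by simp
  qed
  then have take_k: "take k w' = take j w' @ [w' ! j]"
    by (simp add: j take_Suc_conv_app_nth)
  have "0 \<le> height (take j w')" using least j by simp
  \<comment> \<open>Each step changes the height by one, so going from nonnegative to negative is a
    fall from 0.\<close>
  with k take_k have "w' ! j = D" "height (take j w') = 0"
    by (cases "w' ! j"; simp)+
  define u v where "u = take j w'" and "v = drop k w'"
  have w': "w' = u @ D # v"
    using \<open>w' ! j = D\<close> \<open>j < length w'\<close> by (metis id_take_nth_drop j u_def v_def)
  have hu: "height u = 0" by (simp add: u_def \<open>height (take j w') = 0\<close>)
  have "0 \<le> height (take i u)" for i
    using least j by (simp add: u_def)
  then have "is_dyck u"
    using hu by (simp add: is_dyck_def)
  moreover have "is_dyck v"
    unfolding is_dyck_def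
  proof (intro conjI allI)
    show "height v = 0" using total by (simp add: w' hu)
    fix i
    \<comment> \<open>\<open>u @ [D]\<close> has height -1, the lower bound \<open>pre\<close> for
      all prefixes of \<open>w'\<close>, so \<open>v\<close> cannot go below 0.\<close>
    have "take (Suc (length u) + i) w' = u @ D # take i v"
      by (simp add: w')
    with pre[of "Suc (length u) + i"] show "0 \<le> height (take i v)"
      by (simp add: hu)
  qed
  ultimately show thesis using that w w' by blast
qed

text \<open>A longer \<open>u'\<close> would have the prefix \<open>u @ [D]\<close>, whose height is
  -1.\<close>

lemma first_return_unique_aux:
  assumes "is_dyck u" "is_dyck u'" "u @ D # v = u' @ D # v'"
  shows "length u' \<le> length u"
proof (rule ccontr)
  assume "\<not> ?thesis"
  then have "take (Suc (length u)) (u' @ D # v') = take (Suc (length u)) u'" by simp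
  moreover have "take (Suc (length u)) (u @ D # v) = u @ [D]" by simp
  ultimately have "take (Suc (length u)) u' = u @ [D]" using assms(3) by simp
  moreover have "0 \<le> height (take (Suc (length u)) u')"
    using assms(2) unfolding is_dyck_def by blast
  ultimately show False using assms(1) by (simp add: is_dyck_def)
qed

lemma first_return_unique:
  assumes "is_dyck u" "is_dyck u'" "u @ D # v = u' @ D # v'"
  shows "u = u' \<and> v = v'"
  using first_return_unique_aux[OF assms] first_return_unique_aux[OF assms(2,1) assms(3)[symmetric]]
    assms(3) by simp

lemma dyck_paths_0: "dyck_paths 0 = {[]}"
proof -
  have "w = []" if "is_dyck w" "count_list w U = 0" for w
    using is_dyck_split[OF that(1)] that(2) by (metis count_list.simps(2) add_is_0 zero_neq_one)
  then show ?thesis by (auto simp: dyck_paths_eq)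
qed

text \<open>Here \<open>k\<close> is the semilength of \<open>u\<close>, and the enclosing
  \<open>U\<close> accounts for the \<open>Suc\<close>.\<close>

lemma sum_dyck_paths_Suc:
  "(\<Sum>w\<in>dyck_paths (Suc n). F w) =
     (\<Sum>k=0..n. \<Sum>u\<in>dyck_paths k. \<Sum>v\<in>dyck_paths (n - k). F (U # u @ D # v))"
proof -
  let ?S = "SIGMA k:{0..n}. dyck_paths k \<times> dyck_paths (n - k)"
  have "bij_betw (\<lambda>(k, u, v). U # u @ D # v) ?S (dyck_paths (Suc n))"
    unfolding bij_betw_def
  proof
    show "inj_on (\<lambda>(k, u, v). U # u @ D # v) ?S"
      by (auto simp: inj_on_def dyck_paths_eq dest: first_return_unique)
    show "(\<lambda>(k, u, v). U # u @ D # v) ` ?S = dyck_paths (Suc n)"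
    proof (intro equalityI subsetI)
      fix w assume "w \<in> dyck_paths (Suc n)"
      then have "is_dyck w" "w \<noteq> []" and c: "count_list w U = Suc n"
        by (auto simp: dyck_paths_eq)
      then obtain u v where w: "w = U # u @ D # v" and uv: "is_dyck u" "is_dyck v"
        using is_dyck_split by metis
      from c have "count_list u U + count_list v U = n" by (simp add: w)
      then have "(count_list u U, u, v) \<in> ?S"
        using uv by (auto simp: dyck_paths_eq)
      then show "w \<in> (\<lambda>(k, u, v). U # u @ D # v) ` ?S"
        unfolding w by (rule rev_image_eqI) simp
    qed (auto simp: dyck_paths_eq is_dyck_join)
  qed
  then have "(\<Sum>w\<in>dyck_paths (Suc n). F w) = (\<Sum>(k, u, v)\<in>?S. F (U # u @ D # v))"
    by (simp add: sum.reindex_bij_betw[symmetric] case_prod_unfold)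
  also have "\<dots> = (\<Sum>k=0..n. \<Sum>(u, v)\<in>dyck_paths k \<times> dyck_paths (n - k). F (U # u @ D # v))"
    by (subst sum.Sigma) (auto simp: finite_dyck_paths)
  finally show ?thesis
    by (simp add: sum.cartesian_product)
qed

section \<open>Valleys and triple falls\<close>

lemma occurrences_Nil: "p \<noteq> [] \<Longrightarrow> occurrences p [] = 0"
  by (simp add: occurrences_def)

lemma occurrences_Cons:
  fixes w :: "step list"
  shows "occurrences p (a # w) = (if take (length p) (a # w) = p then 1 else 0) + occurrences p w"
proof -
  let ?P = "\<lambda>w i. i + length p \<le> length w \<and> take (length p) (drop i w) = p"
  have fin: "finite {i. ?P w i}" for w :: "step list"
    by (rule finite_subset[of _ "{..length w}"]) auto
  \<comment> \<open>A match at position 0 forces the length condition of \<open>occurrences\<close>,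
    so testing \<open>take\<close> alone is enough there.\<close>
  have le: "length p \<le> Suc (length w)" if "take (length p) (a # w) = p"
    using arg_cong[OF that, of length] by simp
  have "{i. ?P (a # w) i} = (if take (length p) (a # w) = p then {0} else {}) \<union> Suc ` {i. ?P w i}"
    (is "?L = ?R")
  proof (rule set_eqI)
    fix i show "i \<in> ?L \<longleftrightarrow> i \<in> ?R"
      using le by (cases i) auto
  qed
  then show ?thesis
    unfolding occurrences_def using fin[of w] by (simp add: card_image)
qed

lemma valleys_simps [simp]:
  "valleys [] = 0"
  "valleys (U # w) = valleys w"
  "valleys [D] = 0"
  "valleys (D # D # w) = valleys (D # w)"
  "valleys (D # U # w) = Suc (valleys w)"
  by (simp_all add: valleys_def occurrences_Nil occurrences_Cons)

lemma triple_falls_simps [simp]: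
  "triple_falls [] = 0"
  "triple_falls (U # w) = triple_falls w"
  "triple_falls [D] = 0"
  "triple_falls [D, D] = 0"
  "triple_falls (D # U # w) = triple_falls w"
  "triple_falls (D # D # U # w) = triple_falls w"
  "triple_falls (D # D # D # w) = Suc (triple_falls (D # D # w))"
  by (simp_all add: triple_falls_def occurrences_Nil occurrences_Cons)

text \<open>Recursion from the front makes the induction rule expose three letters, the window that
  \<open>triple_falls\<close> inspects.\<close>

fun ends_DD :: "step list \<Rightarrow> bool" where
  "ends_DD [] = False"
| "ends_DD [a] = False"
| "ends_DD [a, b] = (a = D \<and> b = D)"
| "ends_DD (a # b # c # w) = ends_DD (b # c # w)"

lemma ends_DD_append: "2 \<le> length v \<Longrightarrow> ends_DD (u @ v) = ends_DD v"
proof (induction u)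
  case (Cons a u)
  then have "2 \<le> length (u @ v)" by simp
  with Cons show ?case
    by (cases "u @ v" rule: ends_DD.cases) (auto simp del: length_append)
qed simp

lemma valleys_append_D: "valleys (u @ [D]) = valleys u"
proof (induction u)
  case (Cons a u)
  then show ?case by (cases a; cases u; (cases "hd u")?) auto
qed simp

text \<open>Every pair at the junction ends in \<open>D\<close> or starts with \<open>U\<close>,
  except the displayed \<open>DU\<close>.\<close>

lemma valleys_append_DU: "valleys (u @ D # U # w) = Suc (valleys u + valleys w)"
proof (induction u)
  case (Cons a u)
  then show ?case by (cases a; cases u; (cases "hd u")?) auto
qed simp

lemma triple_falls_append_D:
  "triple_falls (u @ [D]) = triple_falls u + (if ends_DD u then 1 else 0)"
proof (induction u rule: ends_DD.induct)
  case (2 a)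
  then show ?case by (cases a) auto
next
  case (3 a b)
  then show ?case by (cases a; cases b) auto
next
  case (4 a b c w)
  then show ?case by (cases a; cases b; cases c) auto
qed simp

text \<open>The \<open>U\<close> interrupts any run of falls, so the two sides count
  separately.\<close>

lemma triple_falls_append_DU:
  "triple_falls (u @ D # U # w) = triple_falls (u @ [D]) + triple_falls w"
proof (induction u rule: ends_DD.induct)
  case (2 a)
  then show ?case by (cases a) auto
next
  case (3 a b)
  then show ?case by (cases a; cases b) auto
next
  case (4 a b c w)
  then show ?case by (cases a; cases b; cases c) auto
qed simp

text \<open>A nonempty \<open>v\<close> contains the last two letters. Otherwise the letter before
  the closing \<open>D\<close> is the last one of \<open>U # u\<close>, a fall unless
  \<open>u\<close> is empty.\<close>

lemma ends_DD_join:
  assumes "is_dyck u" "is_dyck v"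
  shows "ends_DD (U # u @ D # v) \<longleftrightarrow> (if v = [] then u \<noteq> [] else ends_DD v)"
proof (cases "v = []")
  case True
  show ?thesis
  proof (cases "u = []")
    case False
    then obtain u' where "u = u' @ [D]" using is_dyck_last assms(1) by blast
    then show ?thesis
      using True ends_DD_append[of "[D, D]" "U # u'"] by simp
  qed (simp add: True)
next
  case False
  then have "height v = 0" using assms(2) by (simp add: is_dyck_def)
  then have "2 \<le> length v" using False is_dyck_hd[OF assms(2) False]
    by (cases v rule: ends_DD.cases) auto
  then show ?thesis using False ends_DD_append[of v "U # u @ [D]"] by simp
qed

section \<open>The functional equations\<close>

definition path_gf :: "(step list \<Rightarrow> 'a::comm_ring_1) \<Rightarrow> 'a fps" where
  "path_gf F = Abs_fps (\<lambda>n. \<Sum>w\<in>dyck_paths n. F w)"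

text \<open>The empty path alone makes up the constant term.\<close>

lemma path_gf_if_Nil:
  assumes "F [] = 1"
  shows "path_gf (\<lambda>w. if w = [] then a else c * F w) =
    fps_const a + fps_const c * (path_gf F - 1)"
proof (rule fps_ext)
  fix n
  show "fps_nth (path_gf (\<lambda>w. if w = [] then a else c * F w)) n =
    fps_nth (fps_const a + fps_const c * (path_gf F - 1)) n"
  proof (cases n)
    case 0
    then show ?thesis using assms by (simp add: path_gf_def dyck_paths_0)
  next
    case (Suc m)
    then have "[] \<notin> dyck_paths n" by (simp add: dyck_paths_eq)
    then have "(\<Sum>w\<in>dyck_paths n. if w = [] then a else c * F w) = c * (\<Sum>w\<in>dyck_paths n. F w)"
      unfolding sum_distrib_left by (intro sum.cong) auto
    then show ?thesis using Suc by (simp add: path_gf_def)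
  qed
qed

text \<open>Splitting at the first return is a Cauchy product, shifted by \<open>fps_X\<close> for
  the enclosing pair. Two products are allowed for because \<open>weight_D\<close> needs
  both.\<close>

lemma path_gf_first_return:
  fixes F G H G' H' :: "step list \<Rightarrow> 'a::comm_ring_1"
  assumes "\<And>u v. is_dyck u \<Longrightarrow> is_dyck v \<Longrightarrow> F (U # u @ D # v) = G u * H v + G' u * H' v"
  shows "path_gf F =
    fps_const (F []) + fps_X * (path_gf G * path_gf H + path_gf G' * path_gf H')"
proof (rule fps_ext)
  fix n
  show "fps_nth (path_gf F) n = fps_nth (fps_const (F []) +
    fps_X * (path_gf G * path_gf H + path_gf G' * path_gf H')) n"
  proof (cases n)
    case (Suc m)
    have "(\<Sum>w\<in>dyck_paths (Suc m). F w) =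
      (\<Sum>k=0..m. \<Sum>u\<in>dyck_paths k. \<Sum>v\<in>dyck_paths (m - k). G u * H v + G' u * H' v)"
      unfolding sum_dyck_paths_Suc
      by (intro sum.cong refl assms) (auto simp: dyck_paths_eq)
    moreover have "fps_nth (path_gf G * path_gf H) m =
      (\<Sum>k=0..m. \<Sum>u\<in>dyck_paths k. \<Sum>v\<in>dyck_paths (m - k). G u * H v)" 
      for G H :: "step list \<Rightarrow> 'a"
      by (simp add: path_gf_def fps_mult_nth sum_product)
    moreover have "fps_nth (path_gf F) (Suc m) = (\<Sum>w\<in>dyck_paths (Suc m). F w)"
      by (simp add: path_gf_def)
    ultimately show ?thesis
      by (simp add: Suc sum.distrib)
  qed (simp add: path_gf_def dyck_paths_0)
qed

definition weight :: "'a::comm_ring_1 \<Rightarrow> 'a \<Rightarrow> step list \<Rightarrow> 'a" where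
  "weight y z w = y ^ valleys w * z ^ triple_falls w"

text \<open>What \<open>u\<close> contributes once enclosed by \<open>U\<close> and
  \<open>D\<close>; the series of this weight is \<open>C\<close>.\<close>

definition weight_D :: "'a::comm_ring_1 \<Rightarrow> 'a \<Rightarrow> step list \<Rightarrow> 'a" where
  "weight_D y z w = weight y z (w @ [D])"

lemma weight_D_eq: "weight_D y z w = weight y z w * (if ends_DD w then z else 1)"
  by (simp add: weight_D_def weight_def valleys_append_D triple_falls_append_D)

lemma weight_Nil [simp]: "weight y z [] = 1" "weight_D y z [] = 1"
  by (simp_all add: weight_def weight_D_def)

text \<open>The closing \<open>D\<close> starts a valley exactly if \<open>v\<close> is nonempty,
  whence the \<open>y\<close>.\<close>

lemma weight_join:
  assumes "is_dyck v"
  shows "weight y z (U # u @ D # v) = weight_D y z u * (if v = [] then 1 else y * weight y z v)"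
proof (cases "v = []")
  case False
  then obtain v' where "v = U # v'" using is_dyck_hd assms by blast
  then show ?thesis
    by (simp add: weight_def weight_D_def valleys_append_DU valleys_append_D
        triple_falls_append_DU power_add)
qed (simp add: weight_def weight_D_def)

text \<open>The summands are the cases \<open>v\<close> nonempty and \<open>v\<close> empty; in the
  latter a nonempty \<open>u\<close> makes the path end in \<open>DD\<close>, whence
  \<open>z\<close>. The factor 0 fits the shape of \<open>path_gf_if_Nil\<close>.\<close>

lemma weight_D_join:
  assumes "is_dyck u" "is_dyck v"
  shows "weight_D y z (U # u @ D # v) =
    weight_D y z u * (if v = [] then 0 else y * weight_D y z v)
    + (if u = [] then 1 else z * weight_D y z u) * (if v = [] then 1 else 0 * weight_D y z v)"
  unfolding weight_D_eq[of y z "U # u @ D # v"] weight_D_eq[of y z v] weight_join[OF assms(2)]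
    ends_DD_join[OF assms]
  by simp

lemma path_gf_weight:
  fixes y z :: "'a::comm_ring_1"
  shows "path_gf (weight y z) =
    1 + fps_X * path_gf (weight_D y z) * (1 + fps_const y * (path_gf (weight y z) - 1))"
proof -
  let ?H = "\<lambda>v. if v = [] then 1 else y * weight y z v"
  have "path_gf (weight y z) = fps_const (weight y z []) + fps_X *
    (path_gf (weight_D y z) * path_gf ?H + path_gf (\<lambda>_. 0) * path_gf (\<lambda>_. 0))"
    by (rule path_gf_first_return) (simp add: weight_join)
  moreover have "path_gf (\<lambda>_. 0 :: 'a) = 0"
    by (simp add: path_gf_def fps_eq_iff)
  ultimately show ?thesis
    by (simp add: path_gf_if_Nil mult.assoc)
qed

lemma path_gf_weight_D:
  fixes y z :: "'a::comm_ring_1"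
  defines "C \<equiv> path_gf (weight_D y z)"
  shows "C = 1 + fps_X * (C * (fps_const y * (C - 1)) + (1 + fps_const z * (C - 1)))"
  using path_gf_first_return[where F = "weight_D y z", OF weight_D_join[of _ _ y z]]
  by (simp add: path_gf_if_Nil C_def)

section \<open>Solving the equations\<close>

text \<open>Completing the square: if \<open>a * C^2 + b * C + c = 0\<close> with
  \<open>a = x * y\<close> and \<open>b = x * z - x * y - 1\<close>, then
  \<open>- (2 * a * C + b)\<close> squares to \<open>b^2 - 4 * a * c\<close>.\<close>

lemma discriminant_root:
  fixes x y z C :: "'a::comm_ring_1"
  assumes "C = 1 + x * (C * (y * (C - 1)) + (1 + z * (C - 1)))"
  shows "(1 + x * y - x * z - 2 * x * y * C)^2 =
    1 - 2 * x * y - 4 * x^2 * y + x^2 * y^2 - 2 * x * z + 2 * x^2 * y * z + x^2 * z^2"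
    (is "?S^2 = ?R")
proof -
  have "?S^2 - ?R =
      4 * x * y * ((1 + x * (C * (y * (C - 1)) + (1 + z * (C - 1)))) - C)"
    by (simp add: algebra_simps power2_eq_square)
  with assms show ?thesis by simp
qed

lemma eliminate_C:
  fixes x y z A C :: "'a::idom"
  assumes C: "C = 1 + x * (C * (y * (C - 1)) + (1 + z * (C - 1)))"
    and A: "A = 1 + x * C * (1 + y * (A - 1))"
    and nz: "1 - x * y * C \<noteq> 0"
  shows "A * (2 * x * y * (x * y * z - z - x * y)) =
    - 1 + x * y + 2 * x^2 * y - 2 * x^2 * y^2 + x * z - 2 * x * y * z
        - 2 * x^2 * y * z + 2 * x^2 * y^2 * z + (1 + x * y - x * z - 2 * x * y * C)"
proof -
  have "A * (1 - x * y * C) = 1 + x * C * (1 - y)"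
    using A by algebra
  \<comment> \<open>This inverts \<open>1 - x * y * C\<close> modulo the quadratic:
    \<open>x * y * z - z - x * y\<close> is \<open>- y\<close> times the value of that quadratic at
    \<open>C = 1 / (x * y)\<close>.\<close>
  moreover have "(1 + x * C * (1 - y)) * (x * y * z - z - x * y) -
      (1 - x * y * C) * (1 - z + x - x * y - x * z + x * y * z - C) =
    C - (1 + x * (C * (y * (C - 1)) + (1 + z * (C - 1))))"
    by (simp add: algebra_simps)
  with C have "(1 + x * C * (1 - y)) * (x * y * z - z - x * y) =
      (1 - x * y * C) * (1 - z + x - x * y - x * z + x * y * z - C)"
    by simp
  ultimately have "(1 - x * y * C) * (A * (x * y * z - z - x * y)) =
    (1 - x * y * C) * (1 - z + x - x * y - x * z + x * y * z - C)"
    by (metis mult.assoc mult.commute)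
  with nz have "A * (x * y * z - z - x * y) = 1 - z + x - x * y - x * z + x * y * z - C"
    by simp
  \<comment> \<open>The factor \<open>2 * x * y\<close> produces the term
    \<open>- 2 * x * y * C\<close> of the square root.\<close>
  then have "A * (2 * x * y * (x * y * z - z - x * y)) =
      2 * x * y * (1 - z + x - x * y - x * z + x * y * z - C)"
    by (metis mult.left_commute)
  then show ?thesis by (simp add: algebra_simps power2_eq_square)
qed

lemma indet_nonzero: "indet_y \<noteq> 0" "indet_z \<noteq> 0"
  by (simp_all add: indet_y_def indet_z_def)

theorem theorem5:
  fixes x y z :: "ratfun fps"
  assumes "x = fps_X" and "y = fps_const indet_y" and "z = fps_const indet_z"
  shows "fps_to_fls dyck_gf =
    fps_to_fls (- 1 + x * y + 2 * x^2 * y - 2 * x^2 * y^2 + x * z - 2 * x * y * z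
        - 2 * x^2 * y * z + 2 * x^2 * y^2 * z
        + fps_sqrt1 (1 - 2 * x * y - 4 * x^2 * y + x^2 * y^2 - 2 * x * z
            + 2 * x^2 * y * z + x^2 * z^2))
    / fps_to_fls (2 * x * y * (x * y * z - z - x * y))"
    (is "_ = fps_to_fls (?N + fps_sqrt1 ?R) / fps_to_fls ?Q")
proof -
  define C where "C = path_gf (weight_D indet_y indet_z)"
  have A_eq: "dyck_gf = path_gf (weight indet_y indet_z)"
    by (simp add: dyck_gf_def path_gf_def weight_def)
  have A: "dyck_gf = 1 + x * C * (1 + y * (dyck_gf - 1))"
    unfolding A_eq C_def assms by (rule path_gf_weight)
  have C: "C = 1 + x * (C * (y * (C - 1)) + (1 + z * (C - 1)))"
    unfolding C_def assms by (rule path_gf_weight_D)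
  have x0: "fps_nth x 0 = 0" by (simp add: assms)
  have "fps_nth ?R 0 = 1"
    by (simp add: x0 power2_eq_square)
  moreover have "fps_nth (1 + x * y - x * z - 2 * x * y * C) 0 = 1"
    by (simp add: x0)
  \<comment> \<open>The constant term 1 selects the branch of the root.\<close>
  ultimately have S: "1 + x * y - x * z - 2 * x * y * C = fps_sqrt1 ?R"
    using fps_sqrt1_iff discriminant_root[OF C] by blast
  have "fps_nth (1 - x * y * C) 0 = 1"
    by (simp add: x0)
  then have "1 - x * y * C \<noteq> 0" by force
  from eliminate_C[OF C A this] have eq: "dyck_gf * ?Q = ?N + fps_sqrt1 ?R"
    unfolding S .
  have "fps_nth (x * y * z - z - x * y) 0 = - indet_z"
    by (simp add: x0 assms(3))
  then have "x * y * z - z - x * y \<noteq> 0" using indet_nonzero by force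
  moreover have "x \<noteq> 0" "y \<noteq> 0"
    using indet_nonzero by (simp_all add: assms)
  \<comment> \<open>\<open>?Q\<close> is divisible by \<open>x\<close>, hence no unit among power
    series; in the field of Laurent series being nonzero suffices for the division.\<close>
  ultimately have "fps_to_fls ?Q \<noteq> 0" by simp
  moreover have "fps_to_fls dyck_gf * fps_to_fls ?Q = fps_to_fls (?N + fps_sqrt1 ?R)"
    unfolding eq[symmetric] by (rule fls_times_fps_to_fls[symmetric])
  ultimately show ?thesis
    by (simp only: eq_divide_eq) simp
qed

end
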